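(* Let $\mathcal{I}$ and $\mathcal{K}$ be ideals on a set $S$ and let $X$ be a first countable topological space which is not finitely generated. Suppose that for every function $f\colon S\to X$ and every $x\in X$, if $f$ is $\mathcal{I}$-convergent to $x$ then $f$ is $\mathcal{I}^{\mathcal{K}}$-convergent to $x$. Then the ideal $\mathcal{I}$ has the additive property with respect to $\mathcal{K}$, that is, $\mathrm{AP}(\mathcal{I},\mathcal{K})$ holds.
   Context: An ideal on a set $S$ is a system $\mathcal{I}\subseteq\mathcal{P}(S)$ with $\emptyset\in\mathcal{I}$, closed under finite unions and under taking subsets; it is not required to be proper (i.e. $S\in\mathcal I$ is allowed) nor to contain the singletons. $\mathcal{F}(\mathcal{I})=\{S\setminus A : A\in\mathcal{I}\}$ denotes the associated filter. A function $f\colon S\to X$ into a topological space is $\mathcal{I}$-convergent to $x\in X$ if $f^{-1}(U)\in\mathcal{F}(\mathcal{I})$ for every neighborhood $U$ of $x$. For ideals $\mathcal{I},\mathcal{K}$ on $S$, $f\colon S\to X$ is $\mathcal{I}^{\mathcal{K}}$-convergent to $x\in X$ if there exists $M\in\mathcal{F}(\mathcal{I})$ such that the function $g\colon S\to X$ given by $g(s)=f(s)$ for $s\in M$ and $g(s)=x$ for $s\notin M$ is $\mathcal{K}$-convergent to $x$. $\mathcal{I}$ has the additive property with respect to $\mathcal{K}$, written $\mathrm{AP}(\mathcal{I},\mathcal{K})$, if for every sequence $(A_n)_{n\in\mathbb{N}}$ of sets from $\mathcal{I}$ there is $A\in\mathcal{I}$ such that $A_n\setminus A\in\mathcal{K}$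 for all $n\in\mathbb{N}$. A topological space $X$ is finitely generated (an Alexandroff space) if any intersection of open subsets of $X$ is open; equivalently, each point of $X$ has a smallest neighborhood. *)

theory Defs
  imports "HOL-Analysis.Analysis"
begin

definition set_ideal :: "'a set \<Rightarrow> 'a set set \<Rightarrow> bool" where
  "set_ideal S I \<longleftrightarrow>
     I \<subseteq> Pow S \<and> {} \<in> I \<and>
     (\<forall>A\<in>I. \<forall>B\<in>I. A \<union> B \<in> I) \<and>
     (\<forall>A\<in>I. \<forall>B. B \<subseteq> A \<longrightarrow> B \<in> I)"

definition dual_filter :: "'a set \<Rightarrow> 'a set set \<Rightarrow> 'a set set" where
  "dual_filter S I = {S - A | A. A \<in> I}"

(* A neighbourhood need not be open. *)
definition neighbourhood_in :: "'b topology \<Rightarrow> 'b \<Rightarrow> 'b set \<Rightarrow> bool" where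
  "neighbourhood_in X x N \<longleftrightarrow>
     N \<subseteq> topspace X \<and> (\<exists>U. openin X U \<and> x \<in> U \<and> U \<subseteq> N)"

(* A function from S to X is rendered as an f with f \<in> S \<rightarrow> topspace X. Only its
   values on S matter here, since preimages are intersected with S. *)
definition ideal_convergent ::
  "'a set \<Rightarrow> 'b topology \<Rightarrow> 'a set set \<Rightarrow> ('a \<Rightarrow> 'b) \<Rightarrow> 'b \<Rightarrow> bool" where
  "ideal_convergent S X I f x \<longleftrightarrow>
     x \<in> topspace X \<and>
     (\<forall>U. neighbourhood_in X x U \<longrightarrow> f -` U \<inter> S \<in> dual_filter S I)"

definition ideal2_convergent ::
  "'a set \<Rightarrow> 'b topology \<Rightarrow> 'a set set \<Rightarrow> 'a set set \<Rightarrow> ('a \<Rightarrow> 'b) \<Rightarrow> 'b \<Rightarrow> bool" where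
  "ideal2_convergent S X I K f x \<longleftrightarrow>
     (\<exists>M\<in>dual_filter S I.
        ideal_convergent S X K (\<lambda>s. if s \<in> M then f s else x) x)"

definition additive_property :: "'a set set \<Rightarrow> 'a set set \<Rightarrow> bool" where
  "additive_property I K \<longleftrightarrow>
     (\<forall>A :: nat \<Rightarrow> 'a set. (\<forall>n. A n \<in> I) \<longrightarrow> (\<exists>B\<in>I. \<forall>n. A n - B \<in> K))"

(* Intersecting with the whole space makes the empty intersection equal to the
   space itself, rather than to UNIV. *)
definition finitely_generated_space :: "'b topology \<Rightarrow> bool" where
  "finitely_generated_space X \<longleftrightarrow>
     (\<forall>\<U>. (\<forall>U\<in>\<U>. openin X U) \<longrightarrow> openin X (topspace X \<inter> \<Inter>\<U>))"

end

theory Submission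
  imports Defs
begin

text \<open>
  Some point \<open>x\<close> of a space that is not finitely generated has no smallest neighbourhood, so a
  decreasing countable base \<open>V n\<close> at \<open>x\<close> comes with points \<open>p n \<in> V n\<close> that converge to \<open>x\<close> while
  each \<open>p n\<close> misses some neighbourhood \<open>W n\<close> of \<open>x\<close>. Given sets \<open>A n\<close> in \<open>I\<close>, send
  \<open>s\<close> to \<open>p n\<close> for the least \<open>n\<close> with \<open>s \<in> A n\<close>, and to \<open>x\<close> if there is none. This function is
  \<open>I\<close>-convergent to \<open>x\<close>. The complement \<open>B\<close> of the set witnessing \<open>I\<^sup>K\<close>-convergence works,
  because the function maps \<open>A n - B\<close> outside the neighbourhood \<open>W 0 \<inter> \<dots> \<inter> W n\<close>.
\<close>

lemma set_ideal_subset: "set_ideal S I \<Longrightarrow> A \<in> I \<Longrightarrow> B \<subseteq> A \<Longrightarrow> B \<in> I"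
  unfolding set_ideal_def by metis

lemma set_ideal_subset_carrier: "set_ideal S I \<Longrightarrow> A \<in> I \<Longrightarrow> A \<subseteq> S"
  unfolding set_ideal_def by (meson PowD subsetD)

lemma set_ideal_UN:
  assumes "set_ideal S I" and "finite N" and "\<And>n. n \<in> N \<Longrightarrow> A n \<in> I"
  shows "(\<Union>n\<in>N. A n) \<in> I"
  using assms(2,3)
proof (induction N)
  case empty
  then show ?case
    using assms(1) by (simp add: set_ideal_def)
next
  case (insert n N)
  then have "A n \<in> I" and "(\<Union>n\<in>N. A n) \<in> I"
    by simp_all
  then have "A n \<union> (\<Union>n\<in>N. A n) \<in> I"
    using assms(1) unfolding set_ideal_def by metis
  then show ?case
    by simp
qed

lemma in_dual_filter_iff:
  assumes "set_ideal S I" and "P \<subseteq> S"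
  shows "P \<in> dual_filter S I \<longleftrightarrow> S - P \<in> I"
proof
  assume "P \<in> dual_filter S I"
  then obtain A where "A \<in> I" "P = S - A"
    unfolding dual_filter_def by blast
  then show "S - P \<in> I"
    using set_ideal_subset[OF assms(1), of A "S - P"] by blast
next
  assume "S - P \<in> I"
  moreover have "P = S - (S - P)"
    using assms(2) by blast
  ultimately show "P \<in> dual_filter S I"
    unfolding dual_filter_def by blast
qed

text \<open>Take open sets whose intersection is not open, and a point \<open>x\<close> of the
  intersection that is not interior to it. An open \<open>V\<close> around \<open>x\<close> leaves
  the intersection, hence fails to lie in some member, which serves as \<open>W\<close>.\<close>

lemma not_finitely_generated_obtains_point:
  assumes "\<not> finitely_generated_space X"
  obtains x where "x \<in> topspace X"
    and "\<And>V. openin X V \<Longrightarrow> x \<in> V \<Longrightarrow> \<exists>W. openin X W \<and> x \<in> W \<and> \<not> V \<subseteq> W"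
proof -
  obtain \<U> where \<U>: "\<forall>U\<in>\<U>. openin X U" and "\<not> openin X (topspace X \<inter> \<Inter>\<U>)"
    using assms unfolding finitely_generated_space_def by blast
  then have "\<exists>x\<in>topspace X \<inter> \<Inter>\<U>. \<forall>V. openin X V \<longrightarrow> x \<in> V \<longrightarrow> \<not> V \<subseteq> topspace X \<inter> \<Inter>\<U>"
    by (subst (asm) openin_subopen) (simp, metis)
  then obtain x where x: "x \<in> topspace X \<inter> \<Inter>\<U>"
    and none: "\<And>V. openin X V \<Longrightarrow> x \<in> V \<Longrightarrow> \<not> V \<subseteq> topspace X \<inter> \<Inter>\<U>"
    by metis
  show thesis
  proof (rule that)
    show "x \<in> topspace X"
      using x by blast
    show "\<exists>W. openin X W \<and> x \<in> W \<and> \<not> V \<subseteq> W" if "openin X V" "x \<in> V" for V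
      using none[OF that] openin_subset[OF that(1)] \<U> x by blast
  qed
qed

text \<open>Enumerate the members of a countable local base that contain \<open>x\<close>, possibly
  with repetitions, and intersect initial segments.\<close>

lemma first_countable_obtains_decreasing_base:
  assumes "first_countable X" and "x \<in> topspace X"
  obtains V :: "nat \<Rightarrow> 'b set" where "\<And>n. openin X (V n)" and "\<And>n. x \<in> V n" and "antimono V"
    and "\<And>U. openin X U \<Longrightarrow> x \<in> U \<Longrightarrow> \<exists>n. V n \<subseteq> U"
proof -
  obtain \<B> where "countable \<B>" and op: "\<And>V. V \<in> \<B> \<Longrightarrow> openin X V"
    and base: "\<And>U. openin X U \<Longrightarrow> x \<in> U \<Longrightarrow> \<exists>V\<in>\<B>. x \<in> V \<and> V \<subseteq> U"
    using assms unfolding first_countable_def by metis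
  define \<C> where "\<C> = {V \<in> \<B>. x \<in> V}"
  have "countable \<C>"
    unfolding \<C>_def using \<open>countable \<B>\<close> by simp
  moreover have "\<C> \<noteq> {}"
    using base[of "topspace X"] assms(2) unfolding \<C>_def by auto
  ultimately obtain C :: "nat \<Rightarrow> 'b set" where C: "range C = \<C>"
    by (metis range_from_nat_into)
  have Cn: "openin X (C n)" "x \<in> C n" for n
    using C op unfolding \<C>_def by blast+
  show thesis
  proof (rule that[of "\<lambda>n. \<Inter>i\<le>n. C i"])
    show "openin X (\<Inter>i\<le>n. C i)" for n
      using Cn by (intro openin_Inter) auto
    show "x \<in> (\<Inter>i\<le>n. C i)" for n
      using Cn by blast
    show "antimono (\<lambda>n. \<Inter>i\<le>n. C i)"
      by (intro antimonoI INF_superset_mono) auto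
    show "\<exists>n. (\<Inter>i\<le>n. C i) \<subseteq> U" if U: "openin X U" "x \<in> U" for U
    proof -
      obtain B where "B \<in> \<C>" "B \<subseteq> U"
        using base[OF U] unfolding \<C>_def by blast
      then obtain n where "C n \<subseteq> U"
        unfolding C[symmetric] by auto
      then show ?thesis
        by (intro exI[of _ n]) auto
    qed
  qed
qed

theorem theorem3p12:
  fixes S :: "'a set" and I K :: "'a set set" and X :: "'b topology"
  assumes "set_ideal S I" and "set_ideal S K"
    and "first_countable X"
    and "\<not> finitely_generated_space X"
    and "\<forall>f \<in> S \<rightarrow> topspace X. \<forall>x \<in> topspace X.
           ideal_convergent S X I f x \<longrightarrow> ideal2_convergent S X I K f x"
  shows "additive_property I K"
  unfolding additive_property_def
proof (intro allI impI)
  fix A :: "nat \<Rightarrow> 'a set"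
  assume A: "\<forall>n. A n \<in> I"
  obtain x where x: "x \<in> topspace X"
    and nsm: "\<And>V. openin X V \<Longrightarrow> x \<in> V \<Longrightarrow> \<exists>W. openin X W \<and> x \<in> W \<and> \<not> V \<subseteq> W"
    using not_finitely_generated_obtains_point[OF assms(4)] by blast
  obtain V :: "nat \<Rightarrow> 'b set" where V: "\<And>n. openin X (V n)" "\<And>n. x \<in> V n" "antimono V"
    and base: "\<And>U. openin X U \<Longrightarrow> x \<in> U \<Longrightarrow> \<exists>n. V n \<subseteq> U"
    using first_countable_obtains_decreasing_base[OF assms(3) x] by blast
  have "\<exists>W p. openin X W \<and> x \<in> W \<and> p \<in> V n \<and> p \<notin> W" for n
    using nsm[OF V(1,2)] by blast
  then obtain W p where W: "\<And>n. openin X (W n)" "\<And>n. x \<in> W n"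
    and p: "\<And>n. p n \<in> V n" "\<And>n. p n \<notin> W n"
    by metis
  define f where "f s = (if \<exists>n. s \<in> A n then p (LEAST n. s \<in> A n) else x)" for s
  have "p n \<in> topspace X" for n
    using p(1) openin_subset[OF V(1)] by blast
  then have f_range: "f \<in> S \<rightarrow> topspace X"
    using x unfolding f_def by simp
  \<comment> \<open>Choosing the least index bounds it from both sides: by \<open>n\<close> from
    above on \<open>A n\<close>, and by \<open>n\<close> from below off the sets \<open>A i\<close>
    with \<open>i < n\<close>.\<close>
  have f_A: "\<exists>m\<le>n. f s = p m" if "s \<in> A n" for s n
    using that Least_le[of "\<lambda>n. s \<in> A n" n] unfolding f_def by auto
  have f_V: "f s \<in> V n" if "s \<notin> (\<Union>i<n. A i)" for s n
  proof (cases "\<exists>i. s \<in> A i")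
    case True
    then have "s \<in> A (LEAST i. s \<in> A i)"
      by (rule LeastI_ex)
    then have "n \<le> (LEAST i. s \<in> A i)"
      using that by (meson UN_I lessThan_iff not_le)
    then have "V (LEAST i. s \<in> A i) \<subseteq> V n"
      using V(3) by (simp add: antimonoD)
    then show ?thesis
      using True p(1) unfolding f_def by auto
  next
    case False
    then show ?thesis
      using V(2) unfolding f_def by simp
  qed
  have "ideal_convergent S X I f x"
    unfolding ideal_convergent_def
  proof (intro conjI allI impI x)
    \<comment> \<open>Only points of finitely many \<open>A i\<close> can be sent outside
      \<open>U\<close>, and \<open>I\<close> is closed under finite unions.\<close>
    fix U
    assume "neighbourhood_in X x U"
    then obtain n where "V n \<subseteq> U"
      unfolding neighbourhood_in_def using base by (meson subset_trans)
    then have "S - f -` U \<inter> S \<subseteq> (\<Union>i<n. A i)"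
      using f_V by blast
    moreover have "(\<Union>i<n. A i) \<in> I"
      using A by (intro set_ideal_UN[OF assms(1)]) auto
    ultimately show "f -` U \<inter> S \<in> dual_filter S I"
      using set_ideal_subset[OF assms(1)] by (subst in_dual_filter_iff[OF assms(1)]) auto
  qed
  then have "ideal2_convergent S X I K f x"
    using assms(5) f_range x by blast
  then obtain B where B: "B \<in> I"
    and conv: "ideal_convergent S X K (\<lambda>s. if s \<in> S - B then f s else x) x"
    unfolding ideal2_convergent_def dual_filter_def by blast
  have "A n - B \<in> K" for n
  proof -
    \<comment> \<open>On \<open>A n\<close> the value of \<open>f\<close> may be any of
      \<open>p 0\<close>, ..., \<open>p n\<close>, and \<open>p m\<close> is only known to miss
      \<open>W m\<close>; so all these \<open>W i\<close> are intersected, finitely many to keep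
      \<open>?N\<close> open.\<close>
    let ?N = "\<Inter>i\<le>n. W i" and ?g = "\<lambda>s. if s \<in> S - B then f s else x"
    have "openin X ?N"
      using W(1) by (intro openin_Inter) auto
    then have "neighbourhood_in X x ?N"
      unfolding neighbourhood_in_def using W(2) openin_subset by blast
    then have "?g -` ?N \<inter> S \<in> dual_filter S K"
      using conv unfolding ideal_convergent_def by blast
    then have "S - ?g -` ?N \<inter> S \<in> K"
      by (subst (asm) in_dual_filter_iff[OF assms(2)]) auto
    moreover have "A n - B \<subseteq> S - ?g -` ?N \<inter> S"
    proof
      fix s
      assume s: "s \<in> A n - B"
      \<comment> \<open>Membership in \<open>S\<close> makes \<open>?g s\<close> equal to
        \<open>f s\<close>; off \<open>S - B\<close> the value is \<open>x\<close>, which lies in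
        \<open>?N\<close>.\<close>
      then have "s \<in> S"
        using A set_ideal_subset_carrier[OF assms(1), of "A n"] by auto
      obtain m where m: "m \<le> n" "f s = p m"
        using f_A[of s n] s by auto
      then have "f s \<notin> ?N"
        using p(2)[of m] by auto
      then show "s \<in> S - ?g -` ?N \<inter> S"
        using s \<open>s \<in> S\<close> by auto
    qed
    ultimately show ?thesis
      by (rule set_ideal_subset[OF assms(2)])
  qed
  then show "\<exists>B\<in>I. \<forall>n. A n - B \<in> K"
    using B by blast
qed

end
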